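(* Let $\mathcal{A}$ be a parametric timed automaton with private location $\ell_{priv}$ and final location $\ell_f$. Let $\mathrm{d}\text{-}\exists\mathrm{OS}(\mathcal{A})$ be the set of pairs $(v,d)$ of a parameter valuation $v$ and an execution time $d$ such that $v(\mathcal{A})$ is $\exists$-ET-opaque and $v(\mathcal{A})$ is ET-opaque for the execution time $d$. Then $$\mathrm{d}\text{-}\exists\mathrm{OS}(\mathcal{A})=\mathrm{PET}\big(\mathcal{A}^{\ell_{priv}}_{\ell_f}\big)\cap\mathrm{PET}\big(\mathcal{A}^{\neg\ell_{priv}}_{\ell_f}\big).$$
   Context: Clocks and delays take values in $\mathbb{R}_{\ge 0}$; a parameter valuation is a function $v:\mathbb{P}\to\mathbb{N}$. A parametric timed automaton (PTA) is a tuple $\mathcal{A}=(\Sigma,L,\ell_0,\ell_{priv},\ell_f,\mathbb{X},\mathbb{P},I,E)$ with finite sets $\Sigma$ of actions and $L$ of locations, initial, private and final locations $\ell_0,\ell_{priv},\ell_f\in L$, finite sets $\mathbb{X}$ of clocks and $\mathbb{P}=\{p_1,\dots,p_M\}$ of parameters, an invariant $I$ assigning a clock guard to every location, and a finite set $E$ of edges $(\ell,g,a,R,\ell')$ with $g$ a clock guard, $a\in\Sigma$, and $R\subseteq\mathbb{X}$ the clocks reset to $0$. A clock guard is a conjunction of inequalities $x\bowtie\sum_i\alpha_i p_i+\gamma$ with $x\in\mathbb{X}$, $\alpha_i,\gamma\in\mathbb{Z}$, ${\bowtie}\in\{<,\le,=,\ge,>\}$. For a parameter valuation $v$, $v(\mathcal{A})$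 is the timed automaton obtained by replacing each $p_i$ by $v(p_i)$. Its states are pairs $(\ell,\mu)$ with $\mu$ a clock valuation satisfying $v(I(\ell))$; the initial state is $(\ell_0,\vec 0)$. A step $(\ell,\mu)\xrightarrow{(\delta,e)}(\ell',\mu')$ with $e=(\ell,g,a,R,\ell')$ consists of a delay $\delta\ge 0$ in $\ell$ (all clocks increase by $\delta$, the invariant holding throughout) followed by taking $e$ (the guard must hold, clocks in $R$ are reset to $0$, and the resulting state must satisfy the invariant of $\ell'$). A finite run starts from the initial state and has the form $(\ell_0,\mu_0),(\delta_0,e_0),\dots,(\ell_n,\mu_n)$; its duration is $\sum_{i<n}\delta_i$. A private run is a run with $\ell_n=\ell_f$, $\ell_i\ne\ell_f$ for all $i<n$, and $\ell_m=\ell_{priv}$ for some $m<n$. A public run is a run with $\ell_n=\ell_f$ and $\ell_i\notin\{\ell_{priv},\ell_f\}$ for all $i<n$. Let $D^{priv}(v)$ and $D^{pub}(v)$ be the sets of durations of private, resp. public, runs of $v(\mathcal{A})$. $v(\mathcal{A})$ is ET-opaque for the execution time $d$ if $d\in D^{priv}(v)\cap D^{pub}(v)$, and $\exists$-ET-opaque if $D^{priv}(v)\cap D^{pub}(v)\ne\emptyset$. $\mathrm{PET}(\mathcal{B})$, for a PTA $\mathcal{B}$ with final location $\ell_f$, is the set of pairs $(v,d)$ such that $v(\mathcal{B})$ has a finite run of duration $d$ with $\ell_n=\ell_f$ and $\ell_i\ne\ell_f$ for all $0\le i\le n-1$. $\mathcal{A}^{\ell_{priv}}_{\ell_f}$ is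 a copy of $\mathcal{A}$ such that a Boolean variable $b$ (syntactic sugar for doubling the number of locations) is added and initialized to False, $b$ is set to True on all incoming edges to $\ell_{priv}$, and a guard $b=\mathrm{True}$ is added to all incoming edges to $\ell_f$. $\mathcal{A}^{\neg\ell_{priv}}_{\ell_f}$ is a copy of $\mathcal{A}$ in which all incoming and outgoing edges to and from $\ell_{priv}$ are pruned. *)

theory Defs
  imports Complex_Main "HOL-Library.FuncSet"
begin

datatype cmp = Lt | Le | Eq | Ge | Gt

fun cmp_holds :: "cmp \<Rightarrow> real \<Rightarrow> real \<Rightarrow> bool" where
  "cmp_holds Lt a b \<longleftrightarrow> a < b"
| "cmp_holds Le a b \<longleftrightarrow> a \<le> b"
| "cmp_holds Eq a b \<longleftrightarrow> a = b"
| "cmp_holds Ge a b \<longleftrightarrow> a \<ge> b"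
| "cmp_holds Gt a b \<longleftrightarrow> a > b"

text \<open>
  A guard is a finite conjunction of constraints, each comparing a clock with a right-hand
  side of type \<open>'e\<close>: a linear expression over the parameters in a parametric timed
  automaton, an integer in a timed automaton.
\<close>

type_synonym ('x, 'e) guard = "('x \<times> cmp \<times> 'e) list"

type_synonym ('a, 'l, 'x, 'e) edge = "'l \<times> ('x, 'e) guard \<times> 'a \<times> 'x set \<times> 'l"

record ('a, 'l, 'x, 'e) automaton =
  actions :: "'a set"
  locs :: "'l set"
  init :: 'l
  priv :: 'l
  final :: 'l
  clocks :: "'x set"
  invar :: "'l \<Rightarrow> ('x, 'e) guard"
  edges :: "('a, 'l, 'x, 'e) edge set"

text \<open>
  The pair \<open>(\<alpha>, \<gamma>)\<close> stands for the sum of \<open>\<alpha> p * p\<close> over the parameters \<open>p\<close> of the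
  automaton, plus \<open>\<gamma>\<close>; coefficients outside its parameter set are irrelevant.
\<close>

type_synonym 'p linexp = "('p \<Rightarrow> int) \<times> int"

record ('a, 'l, 'x, 'p) pta = "('a, 'l, 'x, 'p linexp) automaton" +
  params :: "'p set"

type_synonym ('a, 'l, 'x) ta = "('a, 'l, 'x, int) automaton"

definition guard_over :: "'x set \<Rightarrow> ('x, 'e) guard \<Rightarrow> bool" where
  "guard_over X g \<longleftrightarrow> fst ` set g \<subseteq> X"

definition wf_pta :: "('a, 'l, 'x, 'p) pta \<Rightarrow> bool" where
  "wf_pta A \<longleftrightarrow>
     finite (actions A) \<and> finite (locs A) \<and> finite (clocks A) \<and> finite (params A) \<and>
     finite (edges A) \<and>
     init A \<in> locs A \<and> priv A \<in> locs A \<and> final A \<in> locs A \<and>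
     (\<forall>l\<in>locs A. guard_over (clocks A) (invar A l)) \<and>
     (\<forall>(l, g, a, R, l')\<in>edges A.
        l \<in> locs A \<and> guard_over (clocks A) g \<and> a \<in> actions A \<and> R \<subseteq> clocks A \<and> l' \<in> locs A)"


definition param_vals :: "('a, 'l, 'x, 'p) pta \<Rightarrow> ('p \<Rightarrow> nat) set" where
  "param_vals A = params A \<rightarrow>\<^sub>E UNIV"

definition eval_lin :: "'p set \<Rightarrow> ('p \<Rightarrow> nat) \<Rightarrow> 'p linexp \<Rightarrow> int" where
  "eval_lin P v = (\<lambda>(\<alpha>, \<gamma>). (\<Sum>p\<in>P. \<alpha> p * int (v p)) + \<gamma>)"

definition inst_guard :: "'p set \<Rightarrow> ('p \<Rightarrow> nat) \<Rightarrow> ('x, 'p linexp) guard \<Rightarrow> ('x, int) guard" where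
  "inst_guard P v g = map (\<lambda>(x, c, e). (x, c, eval_lin P v e)) g"

definition inst :: "('p \<Rightarrow> nat) \<Rightarrow> ('a, 'l, 'x, 'p) pta \<Rightarrow> ('a, 'l, 'x) ta" where
  "inst v A =
     \<lparr>actions = actions A, locs = locs A, init = init A, priv = priv A, final = final A,
      clocks = clocks A,
      invar = (\<lambda>l. inst_guard (params A) v (invar A l)),
      edges = {(l, inst_guard (params A) v g, a, R, l') | l g a R l'. (l, g, a, R, l') \<in> edges A}\<rparr>"


definition guard_holds :: "('x \<Rightarrow> real) \<Rightarrow> ('x, int) guard \<Rightarrow> bool" where
  "guard_holds \<mu> g \<longleftrightarrow> (\<forall>(x, c, k)\<in>set g. cmp_holds c (\<mu> x) (of_int k))"

definition delay :: "'x set \<Rightarrow> ('x \<Rightarrow> real) \<Rightarrow> real \<Rightarrow> 'x \<Rightarrow> real" where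
  "delay X \<mu> \<delta> = (\<lambda>x\<in>X. \<mu> x + \<delta>)"

definition reset :: "'x set \<Rightarrow> 'x set \<Rightarrow> ('x \<Rightarrow> real) \<Rightarrow> 'x \<Rightarrow> real" where
  "reset X R \<mu> = (\<lambda>x\<in>X. if x \<in> R then 0 else \<mu> x)"

type_synonym ('l, 'x) state = "'l \<times> ('x \<Rightarrow> real)"

definition states :: "('a, 'l, 'x) ta \<Rightarrow> ('l, 'x) state set" where
  "states T = {(l, \<mu>). l \<in> locs T \<and> \<mu> \<in> clocks T \<rightarrow>\<^sub>E {0..} \<and> guard_holds \<mu> (invar T l)}"

definition init_state :: "('a, 'l, 'x) ta \<Rightarrow> ('l, 'x) state" where
  "init_state T = (init T, \<lambda>x\<in>clocks T. 0)"

definition step ::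
  "('a, 'l, 'x) ta \<Rightarrow> ('l, 'x) state \<Rightarrow> real \<times> ('a, 'l, 'x, int) edge \<Rightarrow> ('l, 'x) state \<Rightarrow> bool"
where
  "step T = (\<lambda>(l, \<mu>) (\<delta>, e) (l', \<mu>').
     0 \<le> \<delta> \<and> e \<in> edges T \<and>
     (\<exists>g a R. e = (l, g, a, R, l') \<and>
        (\<forall>t\<in>{0..\<delta>}. guard_holds (delay (clocks T) \<mu> t) (invar T l)) \<and>
        guard_holds (delay (clocks T) \<mu> \<delta>) g \<and>
        \<mu>' = reset (clocks T) R (delay (clocks T) \<mu> \<delta>) \<and>
        (l', \<mu>') \<in> states T))"

text \<open>
  A finite run is given by its states \<open>ss\<close> and its labels \<open>ls\<close>, where \<open>length ls\<close> is the number
  of steps. A run has at least one step. This only matters if the initial location is the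
  final one: no run is private then, but a run without steps would reach the final location
  at time \<open>0\<close> and so count for \<open>PET\<close>.
\<close>

definition run ::
  "('a, 'l, 'x) ta \<Rightarrow> ('l, 'x) state list \<Rightarrow> (real \<times> ('a, 'l, 'x, int) edge) list \<Rightarrow> bool"
where
  "run T ss ls \<longleftrightarrow>
     ls \<noteq> [] \<and> length ss = Suc (length ls) \<and>
     ss ! 0 = init_state T \<and> ss ! 0 \<in> states T \<and>
     (\<forall>i<length ls. step T (ss ! i) (ls ! i) (ss ! Suc i))"

definition loc_at :: "('l, 'x) state list \<Rightarrow> nat \<Rightarrow> 'l" where
  "loc_at ss i = fst (ss ! i)"

definition duration :: "(real \<times> ('a, 'l, 'x, int) edge) list \<Rightarrow> real" where
  "duration ls = (\<Sum>i<length ls. fst (ls ! i))"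

definition reaching_run ::
  "('a, 'l, 'x) ta \<Rightarrow> ('l, 'x) state list \<Rightarrow> (real \<times> ('a, 'l, 'x, int) edge) list \<Rightarrow> bool"
where
  "reaching_run T ss ls \<longleftrightarrow>
     run T ss ls \<and> loc_at ss (length ls) = final T \<and>
     (\<forall>i<length ls. loc_at ss i \<noteq> final T)"

definition private_run ::
  "('a, 'l, 'x) ta \<Rightarrow> ('l, 'x) state list \<Rightarrow> (real \<times> ('a, 'l, 'x, int) edge) list \<Rightarrow> bool"
where
  "private_run T ss ls \<longleftrightarrow>
     run T ss ls \<and> loc_at ss (length ls) = final T \<and>
     (\<forall>i<length ls. loc_at ss i \<noteq> final T) \<and>
     (\<exists>m<length ls. loc_at ss m = priv T)"

definition public_run ::
  "('a, 'l, 'x) ta \<Rightarrow> ('l, 'x) state list \<Rightarrow> (real \<times> ('a, 'l, 'x, int) edge) list \<Rightarrow> bool"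
where
  "public_run T ss ls \<longleftrightarrow>
     run T ss ls \<and> loc_at ss (length ls) = final T \<and>
     (\<forall>i<length ls. loc_at ss i \<notin> {priv T, final T})"

definition D_priv :: "('a, 'l, 'x) ta \<Rightarrow> real set" where
  "D_priv T = {duration ls | ss ls. private_run T ss ls}"

definition D_pub :: "('a, 'l, 'x) ta \<Rightarrow> real set" where
  "D_pub T = {duration ls | ss ls. public_run T ss ls}"

definition ET_opaque_for :: "('a, 'l, 'x) ta \<Rightarrow> real \<Rightarrow> bool" where
  "ET_opaque_for T d \<longleftrightarrow> d \<in> D_priv T \<inter> D_pub T"

definition ex_ET_opaque :: "('a, 'l, 'x) ta \<Rightarrow> bool" where
  "ex_ET_opaque T \<longleftrightarrow> D_priv T \<inter> D_pub T \<noteq> {}"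

definition d_ex_OS :: "('a, 'l, 'x, 'p) pta \<Rightarrow> (('p \<Rightarrow> nat) \<times> real) set" where
  "d_ex_OS A =
     {(v, d). v \<in> param_vals A \<and> ex_ET_opaque (inst v A) \<and> ET_opaque_for (inst v A) d}"

definition PET :: "('a, 'l, 'x, 'p) pta \<Rightarrow> (('p \<Rightarrow> nat) \<times> real) set" where
  "PET B =
     {(v, d). v \<in> param_vals B \<and> (\<exists>ss ls. reaching_run (inst v B) ss ls \<and> duration ls = d)}"

text \<open>
  The second component of a location is the value of the Boolean variable. The guard
  on edges to the final location concerns its value before the edge is taken. The location
  \<open>(final A, False)\<close> has no incoming edges, so the final location is \<open>(final A, True)\<close>.
  The \<open>priv\<close> component of the copy plays no role in \<open>PET\<close>.
\<close>

definition priv_copy :: "('a, 'l, 'x, 'p) pta \<Rightarrow> ('a, 'l \<times> bool, 'x, 'p) pta" where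
  "priv_copy A =
     \<lparr>actions = actions A, locs = locs A \<times> UNIV, init = (init A, False),
      priv = (priv A, True), final = (final A, True), clocks = clocks A,
      invar = (\<lambda>(l, b). invar A l),
      edges = {((l, b), g, a, R, (l', b \<or> l' = priv A)) | l b g a R l'.
                 (l, g, a, R, l') \<in> edges A \<and> (l' = final A \<longrightarrow> b)},
      params = params A\<rparr>"

definition pruned_copy :: "('a, 'l, 'x, 'p) pta \<Rightarrow> ('a, 'l, 'x, 'p) pta" where
  "pruned_copy A =
     A\<lparr>edges := {(l, g, a, R, l') | l g a R l'.
                  (l, g, a, R, l') \<in> edges A \<and> l \<noteq> priv A \<and> l' \<noteq> priv A}\<rparr>"

lemma wf_pta_priv_copy:
  assumes "wf_pta A"
  shows "wf_pta (priv_copy A)"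
proof -
  have "edges (priv_copy A) \<subseteq>
      (\<lambda>((l, g, a, R, l'), b, b'). ((l, b), g, a, R, (l', b'))) ` (edges A \<times> UNIV)"
  proof
    fix e assume "e \<in> edges (priv_copy A)"
    then obtain l b g a R l' where
      "e = ((l, b), g, a, R, (l', b \<or> l' = priv A))" "(l, g, a, R, l') \<in> edges A"
      unfolding priv_copy_def automaton.simps pta.simps mem_Collect_eq by blast
    then show "e \<in> (\<lambda>((l, g, a, R, l'), b, b'). ((l, b), g, a, R, (l', b'))) ` (edges A \<times> UNIV)"
      by (intro image_eqI[where x = "((l, g, a, R, l'), b, b \<or> l' = priv A)"]) auto
  qed
  moreover have "finite (edges A \<times> (UNIV :: (bool \<times> bool) set))"
    using assms by (simp add: wf_pta_def)
  ultimately have "finite (edges (priv_copy A))"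
    by (meson finite_imageI finite_subset)
  then show ?thesis
    using assms by (fastforce simp: wf_pta_def priv_copy_def)
qed

lemma wf_pta_pruned_copy:
  assumes "wf_pta A"
  shows "wf_pta (pruned_copy A)"
proof -
  have "edges (pruned_copy A) \<subseteq> edges A"
    by (auto simp: pruned_copy_def)
  then have "finite (edges (pruned_copy A))"
    using assms finite_subset by (auto simp: wf_pta_def)
  then show ?thesis
    using assms by (fastforce simp: wf_pta_def pruned_copy_def)
qed

end

theory Submission
  imports Defs
begin

text \<open>
  In a run of the copy with the Boolean variable, that variable records whether \<open>priv\<close> has been
  entered by an edge. Forgetting it, or adding it back, therefore translates between runs of the
  copy and private runs, step by step and with the same delays; runs of the pruned copy are runs
  avoiding \<open>priv\<close>. In the degenerate cases where the initial or the final location is private, or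
  the initial location is final, single factors may differ, but both sides of the equation become
  empty: the hypotheses \<open>init A \<noteq> priv A\<close>, \<open>init A \<noteq> final A\<close> and \<open>priv A \<noteq> final A\<close> used
  for one inclusion of one factor always come from a run witnessing the other factor.
\<close>

text \<open>Traces a step back to an edge of \<open>A\<close> with its parametric guard, so that
  comparing a copy with \<open>A\<close> reduces to comparing their edge sets.\<close>

lemma step_inst_iff:
  "step (inst v A) (l, \<mu>) (\<delta>, e) (l', \<mu>') \<longleftrightarrow>
     0 \<le> \<delta> \<and>
     (\<exists>g a R. (l, g, a, R, l') \<in> edges A \<and> e = (l, inst_guard (params A) v g, a, R, l') \<and>
        (\<forall>t\<in>{0..\<delta>}. guard_holds (delay (clocks A) \<mu> t) (inst_guard (params A) v (invar A l))) \<and>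
        guard_holds (delay (clocks A) \<mu> \<delta>) (inst_guard (params A) v g) \<and>
        \<mu>' = reset (clocks A) R (delay (clocks A) \<mu> \<delta>) \<and>
        (l', \<mu>') \<in> states (inst v A))"
  by (auto simp: step_def inst_def)

lemma states_priv_copy_iff:
  "((l, b), \<mu>) \<in> states (inst v (priv_copy A)) \<longleftrightarrow> (l, \<mu>) \<in> states (inst v A)"
  by (simp add: states_def inst_def priv_copy_def)

text \<open>Each edge of the copy is an edge of \<open>A\<close> together with the value
  \<open>b\<close> before it, which fixes the value after it. Edges are quantified away because the
  two automata have labels of different types; delays and clock valuations agree.\<close>

lemma step_priv_copy_iff:
  "(\<exists>e. step (inst v (priv_copy A)) ((l, b), \<mu>) (\<delta>, e) ((l', b'), \<mu>')) \<longleftrightarrow>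
     (\<exists>e. step (inst v A) (l, \<mu>) (\<delta>, e) (l', \<mu>')) \<and>
     (l' = final A \<longrightarrow> b) \<and> b' = (b \<or> l' = priv A)"
proof -
  have "((l, b), g, a, R, (l', b')) \<in> edges (priv_copy A) \<longleftrightarrow>
      (l, g, a, R, l') \<in> edges A \<and> (l' = final A \<longrightarrow> b) \<and> b' = (b \<or> l' = priv A)" for g a R
    by (auto simp: priv_copy_def)
  moreover have "params (priv_copy A) = params A" "clocks (priv_copy A) = clocks A"
    "invar (priv_copy A) (l, b) = invar A l"
    by (simp_all add: priv_copy_def)
  ultimately show ?thesis
    unfolding step_inst_iff states_priv_copy_iff by auto
qed

lemma states_pruned_copy: "states (inst v (pruned_copy A)) = states (inst v A)"
  by (simp add: states_def inst_def pruned_copy_def)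

lemma step_pruned_copy_iff:
  "step (inst v (pruned_copy A)) s (\<delta>, e) s' \<longleftrightarrow>
     step (inst v A) s (\<delta>, e) s' \<and> fst s \<noteq> priv A \<and> fst s' \<noteq> priv A"
proof -
  obtain l \<mu> l' \<mu>' where s: "s = (l, \<mu>)" "s' = (l', \<mu>')"
    by (metis surj_pair)
  have "(l, g, a, R, l') \<in> edges (pruned_copy A) \<longleftrightarrow>
      (l, g, a, R, l') \<in> edges A \<and> l \<noteq> priv A \<and> l' \<noteq> priv A" for g a R
    by (auto simp: pruned_copy_def)
  moreover have "params (pruned_copy A) = params A" "clocks (pruned_copy A) = clocks A"
    "invar (pruned_copy A) = invar A"
    by (simp_all add: pruned_copy_def)
  ultimately show ?thesis
    unfolding s step_inst_iff states_pruned_copy by auto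
qed

text \<open>Every position of a run is the source or target of some step, so pruning edges at
  \<open>priv A\<close> bans it everywhere, including at the last position.\<close>

lemma run_pruned_copy_iff:
  "run (inst v (pruned_copy A)) ss ls \<longleftrightarrow>
     run (inst v A) ss ls \<and> (\<forall>i\<le>length ls. loc_at ss i \<noteq> priv A)"
proof -
  have init: "init_state (inst v (pruned_copy A)) = init_state (inst v A)"
    by (simp add: init_state_def inst_def pruned_copy_def)
  have steps: "step (inst v (pruned_copy A)) (ss ! i) (ls ! i) (ss ! Suc i) \<longleftrightarrow>
      step (inst v A) (ss ! i) (ls ! i) (ss ! Suc i) \<and>
      loc_at ss i \<noteq> priv A \<and> loc_at ss (Suc i) \<noteq> priv A" for i
    using step_pruned_copy_iff[of v A "ss ! i" "fst (ls ! i)" "snd (ls ! i)"]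
    by (simp add: loc_at_def)
  \<comment> \<open>Without any step the left side would say nothing about position 0.\<close>
  have "(\<forall>i<length ls. loc_at ss i \<noteq> priv A \<and> loc_at ss (Suc i) \<noteq> priv A) \<longleftrightarrow>
      (\<forall>i\<le>length ls. loc_at ss i \<noteq> priv A)" if "ls \<noteq> []"
  proof -
    from that obtain k where "length ls = Suc k"
      by (cases ls) auto
    then show ?thesis
      by (auto simp: less_Suc_eq_le intro: le_SucI elim!: le_SucE)
  qed
  then show ?thesis
    unfolding run_def init states_pruned_copy steps by blast
qed

text \<open>A public run avoids \<open>priv A\<close> only before its last position; the pruned copy
  also bans it there, where the location is \<open>final A\<close>. This is the extra
  conjunct.\<close>

lemma reaching_run_pruned_copy_iff:
  "reaching_run (inst v (pruned_copy A)) ss ls \<longleftrightarrow>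
     public_run (inst v A) ss ls \<and> priv A \<noteq> final A"
proof -
  have "final (inst v (pruned_copy A)) = final A" "final (inst v A) = final A"
    "priv (inst v A) = priv A"
    by (simp_all add: inst_def pruned_copy_def)
  then show ?thesis
    unfolding reaching_run_def public_run_def run_pruned_copy_iff
    by (auto simp: le_less)
qed

text \<open>Here \<open>f\<close> depends on the position, not just on the state, so it can carry
  information about the past. Edges are chosen anew at each position; keeping the delays is enough
  to keep the duration.\<close>

lemma run_transfer:
  assumes "run T ss ls"
    and "f 0 = init_state T'" "f 0 \<in> states T'"
    and "\<And>i. i < length ls \<Longrightarrow> \<exists>e. step T' (f i) (fst (ls ! i), e) (f (Suc i))"
  obtains ls' where "run T' (map f [0..<Suc (length ls)]) ls'" "length ls' = length ls"
    "duration ls' = duration ls"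
proof -
  obtain h where h: "\<And>i. i < length ls \<Longrightarrow> step T' (f i) (fst (ls ! i), h i) (f (Suc i))"
    using assms(4) by metis
  define ls' where "ls' = map (\<lambda>i. (fst (ls ! i), h i)) [0..<length ls]"
  have "map f [0..<Suc (length ls)] ! i = f i" if "i \<le> length ls" for i
    using that by (simp del: upt_Suc)
  then have "run T' (map f [0..<Suc (length ls)]) ls'"
    using assms(1-3) h by (simp add: run_def ls'_def del: upt_Suc)
  then show thesis
    by (rule that) (simp_all add: ls'_def duration_def)
qed

lemma loc_at_map_upt: "i \<le> n \<Longrightarrow> loc_at (map f [0..<Suc n]) i = fst (f i)"
  by (simp add: loc_at_def del: upt_Suc)

lemma init_state_priv_copy:
  "init_state (inst v (priv_copy A)) = ((init A, False), \<lambda>x\<in>clocks A. 0)"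
  by (simp add: init_state_def inst_def priv_copy_def)

lemma init_state_inst: "init_state (inst v A) = (init A, \<lambda>x\<in>clocks A. 0)"
  by (simp add: init_state_def inst_def)

lemma private_run_imp_reaching_run_priv_copy:
  assumes "private_run (inst v A) ss ls" and "init A \<noteq> priv A"
  shows "\<exists>ss' ls'. reaching_run (inst v (priv_copy A)) ss' ls' \<and> duration ls' = duration ls"
proof -
  define n where "n = length ls"
  have run: "run (inst v A) ss ls" and last: "loc_at ss n = final A"
    and nonfinal: "\<And>i. i < n \<Longrightarrow> loc_at ss i \<noteq> final A"
    and ex: "\<exists>m<n. loc_at ss m = priv A"
    using assms(1) by (auto simp: private_run_def inst_def n_def)
  have ss0: "ss ! 0 = (init A, \<lambda>x\<in>clocks A. 0)" "ss ! 0 \<in> states (inst v A)"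
    using run init_state_inst[of v A] by (auto simp: run_def)
  have steps: "step (inst v A) (ss ! i) (ls ! i) (ss ! Suc i)" if "i < n" for i
    using run that by (simp add: run_def n_def)
  \<comment> \<open>Position \<open>i\<close> itself counts, since the variable is set by the edge
    that enters \<open>priv A\<close>.\<close>
  define b where "b i \<longleftrightarrow> (\<exists>j\<le>i. loc_at ss j = priv A)" for i
  define f where "f i = ((loc_at ss i, b i), snd (ss ! i))" for i
  have b0: "\<not> b 0"
    using ss0 assms(2) by (simp add: b_def loc_at_def)
  have bSuc: "b (Suc i) \<longleftrightarrow> b i \<or> loc_at ss (Suc i) = priv A" for i
    by (auto simp: b_def le_Suc_eq)
  have "f 0 = init_state (inst v (priv_copy A))"
    using b0 ss0 by (simp add: f_def init_state_priv_copy loc_at_def)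
  moreover have "f 0 \<in> states (inst v (priv_copy A))"
    using ss0 by (simp add: f_def states_priv_copy_iff loc_at_def)
  moreover have "\<exists>e. step (inst v (priv_copy A)) (f i) (fst (ls ! i), e) (f (Suc i))"
    if "i < length ls" for i
  proof -
    have "i < n" using that by (simp add: n_def)
    \<comment> \<open>An edge into \<open>final A\<close> must be the last one, so the private
      visit, being before position \<open>n\<close>, is no later than its source
      \<open>i\<close>.\<close>
    have "b i" if "loc_at ss (Suc i) = final A"
    proof -
      have "n = Suc i" using that nonfinal[of "Suc i"] \<open>i < n\<close> by linarith
      then show ?thesis using ex by (auto simp: b_def less_Suc_eq_le)
    qed
    moreover have "step (inst v A) (loc_at ss i, snd (ss ! i)) (fst (ls ! i), snd (ls ! i))
        (loc_at ss (Suc i), snd (ss ! Suc i))"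
      using steps[OF \<open>i < n\<close>] by (simp add: loc_at_def)
    ultimately show ?thesis
      unfolding f_def step_priv_copy_iff using bSuc by blast
  qed
  ultimately obtain ls' where ls': "run (inst v (priv_copy A)) (map f [0..<Suc (length ls)]) ls'"
    "length ls' = length ls" "duration ls' = duration ls"
    using run_transfer[OF run] by blast
  have "final (inst v (priv_copy A)) = (final A, True)"
    by (simp add: inst_def priv_copy_def)
  moreover have "b n"
    using ex less_imp_le by (auto simp: b_def)
  ultimately have "reaching_run (inst v (priv_copy A)) (map f [0..<Suc (length ls)]) ls'"
    using ls' last nonfinal
    by (simp add: reaching_run_def loc_at_map_upt f_def n_def del: upt_Suc)
  then show ?thesis using ls'(3) by blast
qed

text \<open>The variable starts as False but must be True before the last edge, so
  \<open>priv A\<close> has been entered by then. The hypothesis excludes a start in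
  \<open>(final A, False)\<close>, which is not final in the copy but projects to
  \<open>final A\<close>.\<close>

lemma reaching_run_priv_copy_imp_private_run:
  assumes "reaching_run (inst v (priv_copy A)) ss ls" and "init A \<noteq> final A"
  shows "\<exists>ss' ls'. private_run (inst v A) ss' ls' \<and> duration ls' = duration ls"
proof -
  define n where "n = length ls"
  have run: "run (inst v (priv_copy A)) ss ls" and last: "loc_at ss n = (final A, True)"
    and nonfinal: "\<And>i. i < n \<Longrightarrow> loc_at ss i \<noteq> (final A, True)"
    using assms(1) by (auto simp: reaching_run_def inst_def priv_copy_def n_def)
  define l where "l i = fst (loc_at ss i)" for i
  define b where "b i = snd (loc_at ss i)" for i
  define f where "f i = (l i, snd (ss ! i))" for i
  have ss: "ss ! i = ((l i, b i), snd (ss ! i))" for i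
    by (simp add: l_def b_def loc_at_def)
  have ss0: "ss ! 0 = ((init A, False), \<lambda>x\<in>clocks A. 0)"
    "ss ! 0 \<in> states (inst v (priv_copy A))" and "n > 0"
    using run init_state_priv_copy[of v A] by (auto simp: run_def n_def)
  have steps: "\<exists>e. step (inst v (priv_copy A)) ((l i, b i), snd (ss ! i)) (fst (ls ! i), e)
      ((l (Suc i), b (Suc i)), snd (ss ! Suc i))" if "i < n" for i
    using run that unfolding run_def n_def by (metis ss prod.collapse)
  have step: "\<exists>e. step (inst v A) (f i) (fst (ls ! i), e) (f (Suc i))"
    and enter: "l (Suc i) = final A \<Longrightarrow> b i"
    and bSuc: "b (Suc i) \<longleftrightarrow> b i \<or> l (Suc i) = priv A" if "i < n" for i
    using steps[OF that] unfolding f_def step_priv_copy_iff by blast+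
  have b_imp: "i \<le> n \<Longrightarrow> b i \<Longrightarrow> \<exists>m\<le>i. l m = priv A" for i
  proof (induction i)
    case 0
    then show ?case using ss0 by (simp add: b_def loc_at_def)
  next
    case (Suc i)
    then show ?case using bSuc[of i] by (metis Suc_le_lessD le_SucI less_imp_le order_refl)
  qed
  have lastl: "l n = final A" using last by (simp add: l_def)
  obtain k where k: "n = Suc k" using \<open>n > 0\<close> gr0_implies_Suc by blast
  \<comment> \<open>The guard is tested at the source of the last edge, which places the private
    visit strictly before position \<open>n\<close>.\<close>
  then have "b k" using enter[of k] lastl by simp
  then have ex: "\<exists>m<n. l m = priv A"
    using b_imp[of k] k by (auto simp: less_Suc_eq_le)
  \<comment> \<open>Entering \<open>final A\<close> requires the variable to be True, and it stays
    so; hence the copy would already be in its own final location.\<close>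
  have nonfinal': "l i \<noteq> final A" if "i < n" for i
  proof (cases i)
    case 0
    then show ?thesis using ss0 assms(2) by (simp add: l_def loc_at_def)
  next
    case (Suc j)
    show ?thesis
    proof
      assume "l i = final A"
      moreover from this have "b i" using enter[of j] bSuc[of j] Suc that by simp
      ultimately show False
        using nonfinal[OF that] by (simp add: l_def b_def prod_eq_iff)
    qed
  qed
  have "f 0 = init_state (inst v A)"
    using ss0 by (simp add: f_def l_def loc_at_def init_state_inst)
  moreover have "f 0 \<in> states (inst v A)"
    using ss0(2) ss states_priv_copy_iff unfolding f_def by metis
  ultimately obtain ls' where ls': "run (inst v A) (map f [0..<Suc (length ls)]) ls'"
    "length ls' = length ls" "duration ls' = duration ls"
    using run_transfer[OF run] step n_def by blast
  have "final (inst v A) = final A" "priv (inst v A) = priv A"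
    by (simp_all add: inst_def)
  moreover have "\<exists>m<n. loc_at (map f [0..<Suc n]) m = priv A"
    using ex by (auto simp: loc_at_map_upt f_def simp del: upt_Suc)
  ultimately have "private_run (inst v A) (map f [0..<Suc (length ls)]) ls'"
    using ls' lastl nonfinal'
    by (simp add: private_run_def loc_at_map_upt f_def n_def del: upt_Suc)
  then show ?thesis using ls'(3) by blast
qed

lemma run_locs_init:
  assumes "run (inst v A) ss ls"
  shows "loc_at ss 0 = init A" "0 < length ls"
  using assms by (simp_all add: run_def loc_at_def init_state_inst)

lemma private_run_distinct:
  assumes "private_run (inst v A) ss ls"
  shows "priv A \<noteq> final A"
  using assms by (auto simp: private_run_def inst_def)

text \<open>A run has at least one step, so position 0 is among those where both locations are
  forbidden.\<close>

lemma public_run_distinct: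
  assumes "public_run (inst v A) ss ls"
  shows "init A \<noteq> priv A" "init A \<noteq> final A"
  using assms run_locs_init[of v A ss ls] by (auto simp: public_run_def inst_def)

theorem proposition2:
  fixes A :: "('a, 'l, 'x, 'p) pta"
  assumes "wf_pta A"
  shows "d_ex_OS A = PET (priv_copy A) \<inter> PET (pruned_copy A)"
proof -
  have vals: "param_vals (priv_copy A) = param_vals A" "param_vals (pruned_copy A) = param_vals A"
    by (simp_all add: param_vals_def priv_copy_def pruned_copy_def)
  have D_priv_iff: "d \<in> D_priv T \<longleftrightarrow> (\<exists>ss ls. private_run T ss ls \<and> duration ls = d)"
    and D_pub_iff: "d \<in> D_pub T \<longleftrightarrow> (\<exists>ss ls. public_run T ss ls \<and> duration ls = d)"
    for d and T :: "('a, 'l, 'x) ta"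
    by (auto simp: D_priv_def D_pub_def)
  have "d \<in> D_priv (inst v A) \<inter> D_pub (inst v A) \<longleftrightarrow>
      (\<exists>ss ls. reaching_run (inst v (priv_copy A)) ss ls \<and> duration ls = d) \<and>
      (\<exists>ss ls. reaching_run (inst v (pruned_copy A)) ss ls \<and> duration ls = d)"
    (is "?L \<longleftrightarrow> ?R") for v d
  proof
    assume ?L
    then obtain ss ls ss' ls' where
      "private_run (inst v A) ss ls" "duration ls = d"
      "public_run (inst v A) ss' ls'" "duration ls' = d"
      unfolding Int_iff D_priv_iff D_pub_iff by blast
    then show ?R
      using private_run_imp_reaching_run_priv_copy public_run_distinct(1) private_run_distinct
        reaching_run_pruned_copy_iff by metis
  next
    assume ?R
    then obtain ss ls ss' ls' where
      "reaching_run (inst v (priv_copy A)) ss ls" "duration ls = d"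
      "public_run (inst v A) ss' ls'" "duration ls' = d"
      unfolding reaching_run_pruned_copy_iff by blast
    moreover from this obtain ss'' ls'' where
      "private_run (inst v A) ss'' ls''" "duration ls'' = d"
      using reaching_run_priv_copy_imp_private_run public_run_distinct(2) by metis
    ultimately show ?L
      unfolding Int_iff D_priv_iff D_pub_iff by blast
  qed
  \<comment> \<open>Opacity for a given \<open>d\<close> already witnesses the existential opacity
    in \<open>d_ex_OS\<close>.\<close>
  then show ?thesis
    unfolding d_ex_OS_def PET_def ex_ET_opaque_def ET_opaque_for_def vals by blast
qed

end
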